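(* Let $n\ge 1$ and let $\mathbb{B}_n=\{z\in\mathbb{C}^n:|z_1|^2+\ldots+|z_n|^2<1\}$ be the unit Euclidean ball. Any $3$-extremal $f:\mathbb{D}\to\mathbb{B}_n$ is a $3$-geodesic.
   Context: $\mathbb{D}$ is the open unit disc in $\mathbb{C}$ and $m\ge 2$ is an integer. For a domain $D\subset\mathbb{C}^n$, $\mathcal{O}(\overline{\mathbb{D}},D)$ denotes the set of mappings holomorphic in a neighborhood of $\overline{\mathbb{D}}$ with values in $D$. A holomorphic mapping $f:\mathbb{D}\to D$ is a weak $m$-extremal for pairwise distinct points $\lambda_1,\ldots,\lambda_m\in\mathbb{D}$ if there is no $h\in\mathcal{O}(\overline{\mathbb{D}},D)$ with $h(\lambda_j)=f(\lambda_j)$, $j=1,\ldots,m$. It is an $m$-extremal if it is a weak $m$-extremal for every choice of pairwise distinct $\lambda_1,\ldots,\lambda_m\in\mathbb{D}$. A finite Blaschke product of degree $k\in\{0,1,2,\ldots\}$ is a function $\zeta\prod_{j=1}^k m_{\alpha_j}$ with $|\zeta|=1$, $\alpha_j\in\mathbb{D}$, $m_\alpha(\lambda)=\frac{\lambda-\alpha}{1-\overline{\alpha}\lambda}$. A holomorphic mapping $f:\mathbb{D}\to D$ is an $m$-geodesic if there is a holomorphic $F:D\to\mathbb{D}$ such that $F\circ f$ is a non-constant Blaschke product of degree at most $m-1$. *)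

theory Defs
  imports "HOL-Complex_Analysis.Complex_Analysis"
begin

abbreviation unit_disc :: "complex set" where
  "unit_disc \<equiv> ball 0 1"

definition unit_ball_C :: "(complex ^ 'n) set" where
  "unit_ball_C = {z. (\<Sum>i\<in>UNIV. (cmod (z $ i))\<^sup>2) < 1}"

definition holomorphic_curve_on :: "(complex \<Rightarrow> complex ^ 'n) \<Rightarrow> complex set \<Rightarrow> bool" where
  "holomorphic_curve_on f S \<longleftrightarrow> (\<forall>i. (\<lambda>z. f z $ i) holomorphic_on S)"

(* Holomorphy in several variables, for open D: real Frechet differentiability at every
   point with a complex-linear derivative. *)
definition holomorphic_several_on :: "(complex ^ 'n \<Rightarrow> complex) \<Rightarrow> (complex ^ 'n) set \<Rightarrow> bool" where
  "holomorphic_several_on F D \<longleftrightarrow>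
     (\<forall>z\<in>D. \<exists>L. (F has_derivative L) (at z within D) \<and> (\<forall>c v. L (c *s v) = c * L v))"

(* Functions are total in HOL, so membership below concerns only the values of h near the
   closed disc. *)
definition hol_closed_disc :: "(complex ^ 'n) set \<Rightarrow> (complex \<Rightarrow> complex ^ 'n) set" where
  "hol_closed_disc D =
     {h. \<exists>U. open U \<and> cball 0 1 \<subseteq> U \<and> holomorphic_curve_on h U \<and> h ` U \<subseteq> D}"

definition hol_disc :: "(complex ^ 'n) set \<Rightarrow> (complex \<Rightarrow> complex ^ 'n) set" where
  "hol_disc D = {f. holomorphic_curve_on f unit_disc \<and> f ` unit_disc \<subseteq> D}"

(* The pairwise distinct points are l 1, ..., l m; values of l at other indices are irrelevant. *)
definition distinct_disc_points :: "nat \<Rightarrow> (nat \<Rightarrow> complex) \<Rightarrow> bool" where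
  "distinct_disc_points m l \<longleftrightarrow> l ` {1..m} \<subseteq> unit_disc \<and> inj_on l {1..m}"

definition weak_extremal ::
  "nat \<Rightarrow> (complex ^ 'n) set \<Rightarrow> (nat \<Rightarrow> complex) \<Rightarrow> (complex \<Rightarrow> complex ^ 'n) \<Rightarrow> bool" where
  "weak_extremal m D l f \<longleftrightarrow>
     f \<in> hol_disc D \<and> \<not> (\<exists>h\<in>hol_closed_disc D. \<forall>j\<in>{1..m}. h (l j) = f (l j))"

definition extremal :: "nat \<Rightarrow> (complex ^ 'n) set \<Rightarrow> (complex \<Rightarrow> complex ^ 'n) \<Rightarrow> bool" where
  "extremal m D f \<longleftrightarrow>
     f \<in> hol_disc D \<and> (\<forall>l. distinct_disc_points m l \<longrightarrow> weak_extremal m D l f)"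

(* Moebius_function 0 a z is (z - a) / (1 - cnj a * z).  Equality with the product is
   required on the unit disc only. *)
definition finite_Blaschke :: "nat \<Rightarrow> (complex \<Rightarrow> complex) \<Rightarrow> bool" where
  "finite_Blaschke k B \<longleftrightarrow>
     (\<exists>\<zeta> \<alpha>. cmod \<zeta> = 1 \<and> (\<forall>j\<in>{1..k}. \<alpha> j \<in> unit_disc) \<and>
        (\<forall>z\<in>unit_disc. B z = \<zeta> * (\<Prod>j=1..k. Moebius_function 0 (\<alpha> j) z)))"

definition geodesic :: "nat \<Rightarrow> (complex ^ 'n) set \<Rightarrow> (complex \<Rightarrow> complex ^ 'n) \<Rightarrow> bool" where
  "geodesic m D f \<longleftrightarrow>
     f \<in> hol_disc D \<and>
     (\<exists>F. holomorphic_several_on F D \<and> F ` D \<subseteq> unit_disc \<and>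
          (\<exists>k\<le>m - 1. finite_Blaschke k (F \<circ> f)) \<and> \<not> (F \<circ> f) constant_on unit_disc)"

end

theory Submission
  imports Defs
begin

text \<open>After an automorphism of the ball, \<open>f(0) = 0\<close>, and by the Schwarz lemma \<open>f(z) = z g(z)\<close>, where
  either \<open>g\<close> is a constant unit vector or \<open>g\<close> maps into the ball. In the latter case one more
  Schwarz step and extremality give \<open>g(z) = \<phi>(m(z) v)\<close> with an automorphism \<open>\<phi>\<close>, a Moebius map \<open>m\<close>
  and a unit vector \<open>v\<close>, since otherwise an interpolating map near the closed disc could be written down.
  Hence \<open>1 - \<langle>f(z), f(w)\<rangle>\<close> is, up to a factor \<open>q(z) cnj (q(w))\<close>, the product of \<open>1 - z cnj w\<close> and a
  positive definite Hermitian form in the polynomials of degree at most 1. These two forms can be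
  diagonalised simultaneously by a disc automorphism, which sends \<open>f\<close> to \<open>t A + t\<^sup>2 B\<close> with \<open>A\<close>
  orthogonal to \<open>B\<close> and \<open>|A|\<^sup>2 + |B|\<^sup>2 = 1\<close>, again up to an automorphism of the ball. On this curve
  \<open>(2 \<langle>z, B\<rangle> + \<langle>z, A\<rangle>\<^sup>2 / |A|\<^sup>2) / (1 + |B|\<^sup>2)\<close> takes the value \<open>t\<^sup>2\<close>.\<close>

subsection \<open>The Hermitian inner product\<close>

definition cinner :: "complex ^ 'n \<Rightarrow> complex ^ 'n \<Rightarrow> complex" where
  "cinner z w = (\<Sum>i\<in>UNIV. z $ i * cnj (w $ i))"

lemma cinner_simps [simp]:
  "cinner (z + w) u = cinner z u + cinner w u"
  "cinner (z - w) u = cinner z u - cinner w u"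
  "cinner (c *s z) u = c * cinner z u"
  "cinner u (z + w) = cinner u z + cinner u w"
  "cinner u (z - w) = cinner u z - cinner u w"
  "cinner u (c *s z) = cnj c * cinner u z"
  "cinner 0 u = 0" "cinner u 0 = 0"
  by (simp_all add: cinner_def sum.distrib sum_subtractf sum_distrib_left algebra_simps)

lemma cnj_cinner [simp]: "cnj (cinner z w) = cinner w z"
  by (simp add: cinner_def mult.commute)

lemma norm_vec_sq: "(norm (z :: complex ^ 'n))\<^sup>2 = (\<Sum>i\<in>UNIV. (cmod (z $ i))\<^sup>2)"
  by (simp add: norm_vec_def L2_set_def sum_nonneg)

lemma cinner_self: "cinner z z = of_real ((norm z)\<^sup>2)"
  unfolding cinner_def norm_vec_sq of_real_sum complex_norm_square ..

lemma cinner_self_eq_0_iff [simp]: "cinner z z = 0 \<longleftrightarrow> z = 0"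
  by (simp add: cinner_self)

lemma norm_cinner_le: "cmod (cinner z w) \<le> norm z * norm w"
proof -
  have "cmod (cinner z w) \<le> (\<Sum>i\<in>UNIV. \<bar>cmod (z $ i)\<bar> * \<bar>cmod (w $ i)\<bar>)"
    unfolding cinner_def by (rule order_trans[OF norm_sum]) (simp add: norm_mult)
  also have "\<dots> \<le> norm z * norm w"
    unfolding norm_vec_def by (rule L2_set_mult_ineq)
  finally show ?thesis .
qed

lemma norm_cinner_less_1:
  assumes "norm z < 1" "norm w \<le> 1" shows "cmod (cinner z w) < 1"
proof -
  have "norm z * norm w \<le> norm z" using assms(2) by (intro mult_left_le norm_ge_zero)
  with norm_cinner_le[of z w] assms(1) show ?thesis by linarith
qed

lemma one_minus_cinner_nz:
  assumes "norm z < 1" "norm w \<le> 1" shows "1 - cinner z w \<noteq> 0" "1 - cinner w z \<noteq> 0"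
proof -
  show 1: "1 - cinner z w \<noteq> 0" using norm_cinner_less_1[OF assms] by auto
  have "1 - cinner w z = cnj (1 - cinner z w)" by simp
  with 1 show "1 - cinner w z \<noteq> 0" by (metis complex_cnj_zero_iff)
qed

lemma norm_sq_less_1_iff: "(norm z)\<^sup>2 < 1 \<longleftrightarrow> norm z < 1"
  using abs_square_less_1[of "norm z"] by (simp only: abs_norm_cancel)

lemma unit_ball_C_eq: "unit_ball_C = (ball 0 1 :: (complex ^ 'n) set)"
  unfolding unit_ball_C_def norm_vec_sq[symmetric] norm_sq_less_1_iff by auto

lemma norm_vec_smult: "norm (c *s (z :: complex ^ 'n)) = cmod c * norm z"
proof -
  have "(norm (c *s z))\<^sup>2 = (cmod c * norm z)\<^sup>2"
    by (simp add: norm_vec_sq power_mult_distrib norm_mult sum_distrib_left)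
  then show ?thesis by (simp add: power2_eq_iff_nonneg del: power_mult_distrib)
qed

subsection \<open>Automorphisms of the ball\<close>

text \<open>The involutive automorphism of the ball exchanging \<open>0\<close> and \<open>a\<close>. The usual formula involves the
  projection onto the line through \<open>a\<close>, hence a division by \<open>|a|\<^sup>2 = 1 - s\<^sup>2\<close>; it is cancelled here
  against the factor \<open>1 - s\<close>, so that \<open>a = 0\<close> is not exceptional.\<close>

definition ball_aut :: "complex ^ 'n \<Rightarrow> complex ^ 'n \<Rightarrow> complex ^ 'n" where
  "ball_aut a z = (let s = complex_of_real (sqrt (1 - (norm a)\<^sup>2)) in
     (1 / (1 - cinner z a)) *s (a - s *s z - (cinner z a / (1 + s)) *s a))"

text \<open>Presents \<open>s\<close> as a complex number fixed by conjugation, so that the later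
  identities are pure algebra. Strict positivity of the real root makes \<open>s\<close> and
  \<open>1 + s\<close> invertible.\<close>

lemma ball_aut_scale:
  fixes a :: "complex ^ 'n"
  assumes "norm a < 1"
  shows "\<exists>s. cnj s = s \<and> s \<noteq> 0 \<and> 1 + s \<noteq> 0 \<and> cinner a a = 1 - s\<^sup>2 \<and>
    (\<forall>w. ball_aut a w = (1 / (1 - cinner w a)) *s (a - s *s w - (cinner w a / (1 + s)) *s a))"
proof -
  let ?s = "sqrt (1 - (norm a)\<^sup>2)"
  have pos: "(norm a)\<^sup>2 < 1" using assms by (simp only: norm_sq_less_1_iff)
  then have "?s > 0" by simp
  then have "1 + ?s \<noteq> 0" by linarith
  then have 1: "1 + complex_of_real ?s \<noteq> 0" by (metis of_real_1 of_real_add of_real_eq_0_iff)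
  have 2: "complex_of_real ?s \<noteq> 0" using \<open>?s > 0\<close> by (simp only: of_real_eq_0_iff)
  have "?s\<^sup>2 = 1 - (norm a)\<^sup>2" using pos by simp
  then have 3: "cinner a a = 1 - (complex_of_real ?s)\<^sup>2"
    by (simp add: cinner_self flip: of_real_power)
  have "ball_aut a w = (1 / (1 - cinner w a)) *s
      (a - complex_of_real ?s *s w - (cinner w a / (1 + complex_of_real ?s)) *s a)" for w
    by (simp add: ball_aut_def Let_def)
  with 1 2 3 show ?thesis by (intro exI[of _ "complex_of_real ?s"]) simp
qed

text \<open>The numerators have inner product \<open>(1 - cinner z a) * (1 - cinner a w) - s\<^sup>2
  * (1 - cinner z w)\<close>. Thus \<open>1 - cinner z w\<close> only acquires a factor that splits
  into a function of \<open>z\<close> and one of \<open>w\<close>.\<close>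

lemma ball_aut_kernel:
  assumes "norm a < 1" "norm z < 1" "norm w < 1"
  shows "1 - cinner (ball_aut a z) (ball_aut a w) =
    (1 - cinner a a) * (1 - cinner z w) / ((1 - cinner z a) * (1 - cinner a w))"
proof -
  obtain s where s: "cnj s = s" "s \<noteq> 0" "1 + s \<noteq> 0" "cinner a a = 1 - s\<^sup>2"
    "\<And>w. ball_aut a w = (1 / (1 - cinner w a)) *s (a - s *s w - (cinner w a / (1 + s)) *s a)"
    using ball_aut_scale[OF assms(1)] by blast
  have nz: "1 - cinner z a \<noteq> 0" "1 - cinner a w \<noteq> 0"
    using one_minus_cinner_nz[of z a] one_minus_cinner_nz[of w a] assms by auto
  define Z W where "Z = cinner z a / (1 + s)" and "W = cinner a w / (1 + s)"
  have ZW: "cinner z a = Z * (1 + s)" "cinner a w = W * (1 + s)"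
    using s(3) by (simp_all add: Z_def W_def)
  have N: "ball_aut a z = (1 / (1 - cinner z a)) *s (a - s *s z - Z *s a)"
    "ball_aut a w = (1 / (1 - cinner w a)) *s (a - s *s w - cnj W *s a)"
    unfolding s(5) by (simp_all add: Z_def W_def s(1))
  have "cinner (ball_aut a z) (ball_aut a w) = cinner (a - s *s z - Z *s a) (a - s *s w - cnj W *s a)
      / ((1 - cinner z a) * (1 - cinner a w))"
    unfolding N by (simp only: cinner_simps(3) cinner_simps(6)) (simp del: cinner_simps(1,2,4,5))
  also have "cinner (a - s *s z - Z *s a) (a - s *s w - cnj W *s a) =
     (1 - cinner z a) * (1 - cinner a w) - s\<^sup>2 * (1 - cinner z w)"
    by (simp add: s(1) ZW s(4)) (simp add: algebra_simps power2_eq_square)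
  finally have "1 - cinner (ball_aut a z) (ball_aut a w) =
      s\<^sup>2 * (1 - cinner z w) / ((1 - cinner z a) * (1 - cinner a w))"
    using nz by (simp add: diff_divide_distrib)
  then show ?thesis by (simp add: s(4))
qed

lemma norm_less_1_iff_cinner: "norm z < 1 \<longleftrightarrow> Re (1 - cinner z z) > 0"
  by (simp add: cinner_self norm_sq_less_1_iff flip: of_real_power)

lemma norm_ball_aut:
  assumes "norm a < 1" "norm z < 1" shows "norm (ball_aut a z) < 1"
proof -
  have *: "(1 - cinner z a) * (1 - cinner a z) = of_real ((cmod (1 - cinner z a))\<^sup>2)"
    unfolding complex_norm_square by simp
  have "1 - cinner (ball_aut a z) (ball_aut a z) =
     of_real ((1 - (norm a)\<^sup>2) * (1 - (norm z)\<^sup>2) / (cmod (1 - cinner z a))\<^sup>2)"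
    unfolding ball_aut_kernel[OF assms assms(2)] * unfolding cinner_self by simp
  moreover have "(1 - (norm a)\<^sup>2) * (1 - (norm z)\<^sup>2) / (cmod (1 - cinner z a))\<^sup>2 > 0"
    using assms one_minus_cinner_nz[of z a]
    by (intro divide_pos_pos mult_pos_pos) (auto simp: norm_sq_less_1_iff)
  ultimately show ?thesis by (simp only: norm_less_1_iff_cinner Re_complex_of_real)
qed

lemma ball_aut_ball_aut:
  assumes "norm a < 1" "norm z < 1" shows "ball_aut a (ball_aut a z) = z"
proof -
  obtain s where s: "cnj s = s" "s \<noteq> 0" "1 + s \<noteq> 0" "cinner a a = 1 - s\<^sup>2"
    "\<And>w. ball_aut a w = (1 / (1 - cinner w a)) *s (a - s *s w - (cinner w a / (1 + s)) *s a)"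
    using ball_aut_scale[OF assms(1)] by blast
  define D where "D = 1 - cinner z a"
  define Z where "Z = cinner z a / (1 + s)"
  have nz: "D \<noteq> 0" using one_minus_cinner_nz[of z a] assms by (auto simp: D_def)
  have Z: "cinner z a = Z * (1 + s)" using s(3) by (simp add: Z_def)
  have N: "ball_aut a z = (1 / D) *s (a - s *s z - Z *s a)"
    unfolding s(5) by (simp add: Z_def D_def)
  have "cinner (a - s *s z - Z *s a) a = D - s\<^sup>2"
    by (simp add: s(4) D_def Z) (simp add: algebra_simps power2_eq_square)
  \<comment> \<open>The second application has denominator one minus this value, which is
    \<open>s\<^sup>2 / D\<close>, so that \<open>D\<close> cancels.\<close>
  then have i: "cinner (ball_aut a z) a = (D - s\<^sup>2) / D"
    unfolding N cinner_simps(3) by simp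
  have i1: "1 - (D - s\<^sup>2) / D = s\<^sup>2 / D"
    using nz by (simp add: field_simps)
  have i2: "D - s\<^sup>2 = (1 + s) * (1 - s - Z)"
    by (simp add: D_def Z algebra_simps power2_eq_square)
  have "ball_aut a (ball_aut a z) $ k = z $ k" for k
  proof -
    have "ball_aut a (ball_aut a z) $ k =
      1 / (s\<^sup>2 / D) * (a $ k - s * (1 / D * (a $ k - s * z $ k - Z * a $ k)) - (D - s\<^sup>2) / D / (1 + s) * a $ k)"
      unfolding s(5)[of "ball_aut a z"] i i1 unfolding N
      by (simp only: vector_smult_component vector_minus_component)
    also have "(D - s\<^sup>2) / D / (1 + s) = (1 - s - Z) / D"
      unfolding i2 using s(3) by simp
    also have "1 / (s\<^sup>2 / D) * (a $ k - s * (1 / D * (a $ k - s * z $ k - Z * a $ k)) - (1 - s - Z) / D * a $ k)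
      = (D * a $ k - s * (a $ k - s * z $ k - Z * a $ k) - (1 - s - Z) * a $ k) / s\<^sup>2"
      using nz s(2) by (simp add: field_simps)
    also have "D * a $ k - s * (a $ k - s * z $ k - Z * a $ k) - (1 - s - Z) * a $ k = s\<^sup>2 * z $ k"
      by (simp add: D_def Z algebra_simps power2_eq_square)
    finally show ?thesis using s(2) by simp
  qed
  then show ?thesis by (simp add: vec_eq_iff)
qed

lemma ball_aut_0 [simp]: "ball_aut a 0 = a"
  by (simp add: ball_aut_def Let_def)

lemma ball_aut_self: "norm a < 1 \<Longrightarrow> ball_aut a a = 0"
  using ball_aut_ball_aut[of a 0] by simp

subsection \<open>Holomorphic functions and curves\<close>

lemma bounded_linear_cinner_left: "bounded_linear (\<lambda>z. cinner z w)"
  unfolding cinner_def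
  by (intro bounded_linear_sum bounded_linear_mult_const bounded_linear_vec_nth)

lemma holomorphic_several_cinner: "holomorphic_several_on (\<lambda>z. cinner z w) D"
  unfolding holomorphic_several_on_def
  using bounded_linear.has_derivative[OF bounded_linear_cinner_left has_derivative_ident]
  by (metis cinner_simps(3))

lemma holomorphic_several_const: "holomorphic_several_on (\<lambda>z. c) D"
  unfolding holomorphic_several_on_def
  by (metis has_derivative_const mult_zero_right)

lemma holomorphic_several_add:
  assumes "holomorphic_several_on F D" "holomorphic_several_on G D"
  shows "holomorphic_several_on (\<lambda>z. F z + G z) D"
  unfolding holomorphic_several_on_def
proof
  fix z assume "z \<in> D"
  with assms obtain L M where "(F has_derivative L) (at z within D)" "\<forall>c v. L (c *s v) = c * L v"
    "(G has_derivative M) (at z within D)" "\<forall>c v. M (c *s v) = c * M v"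
    unfolding holomorphic_several_on_def by metis
  then show "\<exists>L. ((\<lambda>z. F z + G z) has_derivative L) (at z within D) \<and> (\<forall>c v. L (c *s v) = c * L v)"
    by (intro exI[of _ "\<lambda>v. L v + M v"] conjI has_derivative_add) (auto simp: algebra_simps)
qed

lemma holomorphic_several_mult:
  assumes "holomorphic_several_on F D" "holomorphic_several_on G D"
  shows "holomorphic_several_on (\<lambda>z. F z * G z) D"
  unfolding holomorphic_several_on_def
proof
  fix z assume "z \<in> D"
  with assms obtain L M where "(F has_derivative L) (at z within D)" "\<forall>c v. L (c *s v) = c * L v"
    "(G has_derivative M) (at z within D)" "\<forall>c v. M (c *s v) = c * M v"
    unfolding holomorphic_several_on_def by metis
  then show "\<exists>L. ((\<lambda>z. F z * G z) has_derivative L) (at z within D) \<and> (\<forall>c v. L (c *s v) = c * L v)"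
    by (intro exI[of _ "\<lambda>v. F z * M v + L v * G z"] conjI has_derivative_mult) (auto simp: algebra_simps)
qed

lemma holomorphic_several_divide:
  assumes "holomorphic_several_on F D" "holomorphic_several_on G D" "\<And>z. z \<in> D \<Longrightarrow> G z \<noteq> 0"
  shows "holomorphic_several_on (\<lambda>z. F z / G z) D"
  unfolding holomorphic_several_on_def
proof
  fix z assume z: "z \<in> D"
  with assms obtain L M where "(F has_derivative L) (at z within D)" "\<forall>c v. L (c *s v) = c * L v"
    "(G has_derivative M) (at z within D)" "\<forall>c v. M (c *s v) = c * M v"
    unfolding holomorphic_several_on_def by metis
  with assms(3)[OF z] show "\<exists>L. ((\<lambda>z. F z / G z) has_derivative L) (at z within D) \<and> (\<forall>c v. L (c *s v) = c * L v)"
    by (intro exI[of _ "\<lambda>v. (L v * G z - F z * M v) / (G z * G z)"] conjI has_derivative_divide')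
      (auto simp: algebra_simps)
qed

text \<open>Vector-valued maps are tested against every \<open>v\<close>, since
  \<open>holomorphic_several_on\<close> speaks of scalar functions. In this form the lemma applies
  to its own conclusion, as two successive automorphisms require.\<close>

lemma holomorphic_several_ball_aut:
  assumes "norm a < 1" "\<And>v. holomorphic_several_on (\<lambda>z. cinner (G z) v) D"
    "\<And>z. z \<in> D \<Longrightarrow> norm (G z) < 1"
  shows "holomorphic_several_on (\<lambda>z. cinner (ball_aut a (G z)) v) D"
proof -
  obtain s where s: "\<And>w. ball_aut a w = (1 / (1 - cinner w a)) *s (a - s *s w - (cinner w a / (1 + s)) *s a)"
    using ball_aut_scale[OF assms(1)] by blast
  have "cinner (ball_aut a (G z)) v = (cinner a v + (- s) * cinner (G z) v
      + (- (cinner a v / (1 + s))) * cinner (G z) a) / (1 + (- 1) * cinner (G z) a)" for z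
    unfolding s by (simp add: diff_divide_distrib add_divide_distrib mult.commute)
  moreover have "1 + (- 1) * cinner (G z) a \<noteq> 0" if "z \<in> D" for z
    using one_minus_cinner_nz[OF assms(3)[OF that], of a] assms(1) by simp
  ultimately show ?thesis
    by (simp only:) (intro holomorphic_several_divide holomorphic_several_add
        holomorphic_several_mult holomorphic_several_const assms(2); assumption)
qed

lemma holomorphic_curve_cinner:
  "holomorphic_curve_on h S \<Longrightarrow> (\<lambda>z. cinner (h z) w) holomorphic_on S"
  unfolding cinner_def holomorphic_curve_on_def by (intro holomorphic_intros) auto

lemma holomorphic_curve_smult:
  "u holomorphic_on S \<Longrightarrow> holomorphic_curve_on h S \<Longrightarrow> holomorphic_curve_on (\<lambda>z. u z *s h z) S"
  unfolding holomorphic_curve_on_def by (auto intro!: holomorphic_intros)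

lemma holomorphic_curve_compose:
  assumes "holomorphic_curve_on h T" "u holomorphic_on S" "u ` S \<subseteq> T"
  shows "holomorphic_curve_on (\<lambda>z. h (u z)) S"
  unfolding holomorphic_curve_on_def
proof
  fix i
  show "(\<lambda>z. h (u z) $ i) holomorphic_on S"
    using holomorphic_on_compose_gen[OF assms(2) _ assms(3), of "\<lambda>z. h z $ i"] assms(1)
    by (simp add: holomorphic_curve_on_def o_def)
qed

lemma holomorphic_curve_subset:
  "holomorphic_curve_on h S \<Longrightarrow> T \<subseteq> S \<Longrightarrow> holomorphic_curve_on h T"
  unfolding holomorphic_curve_on_def using holomorphic_on_subset by blast

lemma holomorphic_curve_ball_aut:
  assumes "norm a < 1" "holomorphic_curve_on h S" "\<And>z. z \<in> S \<Longrightarrow> norm (h z) < 1"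
  shows "holomorphic_curve_on (\<lambda>z. ball_aut a (h z)) S"
  unfolding holomorphic_curve_on_def
proof
  fix i
  obtain s where s: "\<And>w. ball_aut a w = (1 / (1 - cinner w a)) *s (a - s *s w - (cinner w a / (1 + s)) *s a)"
    using ball_aut_scale[OF assms(1)] by blast
  have "ball_aut a (h z) $ i = (a $ i - s * h z $ i - cinner (h z) a * (a $ i / (1 + s))) / (1 - cinner (h z) a)" for z
    unfolding s by (simp add: diff_divide_distrib)
  moreover have "1 - cinner (h z) a \<noteq> 0" if "z \<in> S" for z
    using one_minus_cinner_nz[OF assms(3)[OF that], of a] assms(1) by simp
  moreover have "(\<lambda>z. h z $ i) holomorphic_on S" using assms(2) by (simp add: holomorphic_curve_on_def)
  ultimately show "(\<lambda>z. ball_aut a (h z) $ i) holomorphic_on S"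
    by (simp only:) (intro holomorphic_intros holomorphic_curve_cinner assms(2); simp)
qed

lemma hol_closed_disc_ball_aut:
  assumes "norm a < 1" "h \<in> hol_closed_disc (ball 0 1)"
  shows "(\<lambda>z. ball_aut a (h z)) \<in> hol_closed_disc (ball 0 1)"
proof -
  from assms(2) obtain U where U: "open U" "cball 0 1 \<subseteq> U" "holomorphic_curve_on h U" "h ` U \<subseteq> ball 0 1"
    by (auto simp: hol_closed_disc_def)
  then have "z \<in> U \<Longrightarrow> norm (h z) < 1" for z by auto
  with U show ?thesis unfolding hol_closed_disc_def
    by (auto intro!: exI[of _ U] holomorphic_curve_ball_aut norm_ball_aut assms)
qed

lemma holomorphic_curve_continuous:
  "holomorphic_curve_on h S \<Longrightarrow> continuous_on S h"
  unfolding holomorphic_curve_on_def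
  using continuous_on_vec_lambda[of S "\<lambda>i z. h z $ i"] holomorphic_on_imp_continuous_on by auto

text \<open>The bound on \<open>u\<close> holds on the closed disc only, so nearby the product might
  leave the ball. The neighbourhood is cut down to the preimage of the ball.\<close>

lemma hol_closed_disc_smult:
  assumes "u holomorphic_on V" "open V" "cball 0 1 \<subseteq> V" "\<And>z. z \<in> cball 0 1 \<Longrightarrow> cmod (u z) \<le> 1"
    "h \<in> hol_closed_disc (ball 0 1)"
  shows "(\<lambda>z. u z *s h z) \<in> hol_closed_disc (ball 0 1)"
proof -
  from assms(5) obtain U where U: "open U" "cball 0 1 \<subseteq> U" "holomorphic_curve_on h U" "h ` U \<subseteq> ball 0 1"
    by (auto simp: hol_closed_disc_def)
  define W where "W = (U \<inter> V) \<inter> (\<lambda>z. u z *s h z) -` ball 0 1"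
  have hol: "holomorphic_curve_on (\<lambda>z. u z *s h z) (U \<inter> V)"
    by (intro holomorphic_curve_smult holomorphic_on_subset[OF assms(1)] holomorphic_curve_subset[OF U(3)]) auto
  have "open W" unfolding W_def
    using holomorphic_curve_continuous[OF hol] U(1) assms(2) by (intro continuous_open_preimage) auto
  moreover have "norm (u z *s h z) < 1" if "z \<in> cball 0 1" for z
  proof -
    have "h z \<in> ball 0 1" using U(2,4) that by blast
    then have "norm (h z) < 1" by simp
    moreover have "cmod (u z) * norm (h z) \<le> norm (h z)"
      using assms(4)[OF that] by (intro mult_left_le_one_le) auto
    ultimately show ?thesis by (simp add: norm_vec_smult)
  qed
  then have "cball 0 1 \<subseteq> W" using U(2) assms(3) by (auto simp: W_def)
  moreover have "holomorphic_curve_on (\<lambda>z. u z *s h z) W"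
    using hol by (rule holomorphic_curve_subset) (auto simp: W_def)
  moreover have "(\<lambda>z. u z *s h z) ` W \<subseteq> ball 0 1" by (auto simp: W_def)
  ultimately show ?thesis unfolding hol_closed_disc_def by blast
qed

subsection \<open>The Schwarz lemma for curves in the ball\<close>

text \<open>The scalar Schwarz lemma for \<open>z * k z\<close>, read off for the quotient. At the
  origin \<open>k 0\<close> is the derivative of the product; in the equality case the product is a
  rotation.\<close>

lemma Schwarz_quotient_const:
  assumes "k holomorphic_on ball 0 1" "\<And>z. cmod z < 1 \<Longrightarrow> cmod (z * k z) < 1" "cmod \<xi> < 1"
  shows "cmod (k \<xi>) \<le> 1" "k \<xi> = 1 \<Longrightarrow> cmod z < 1 \<Longrightarrow> k z = 1"
proof -
  define F where "F = (\<lambda>z. z * k z)"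
  have F: "F holomorphic_on ball 0 1" "F 0 = 0" "\<And>z. norm z < 1 \<Longrightarrow> norm (F z) < 1"
    using assms by (auto simp: F_def intro!: holomorphic_intros)
  have "(k has_field_derivative deriv k 0) (at 0)"
    using assms(1) by (intro holomorphic_derivI[where S = "ball 0 1"]) auto
  then have "(F has_field_derivative k 0) (at 0)"
    unfolding F_def by (auto intro!: derivative_eq_intros)
  then have d: "deriv F 0 = k 0" by (rule DERIV_imp_deriv)
  note S = Schwarz_Lemma[OF F assms(3)]
  show "cmod (k \<xi>) \<le> 1"
  proof (cases "\<xi> = 0")
    case True with S(2) d show ?thesis by simp
  next
    case False with S(1) show ?thesis by (simp add: F_def norm_mult)
  qed
  assume k: "k \<xi> = 1" and z: "cmod z < 1"
  have "(\<exists>z. norm z < 1 \<and> z \<noteq> 0 \<and> norm (F z) = norm z) \<or> norm (deriv F 0) = 1"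
  proof (cases "\<xi> = 0")
    case True with k d show ?thesis by simp
  next
    case False with k assms(3) show ?thesis by (auto simp: F_def norm_mult intro!: exI[of _ \<xi>])
  qed
  then obtain \<alpha> where \<alpha>: "\<And>z. norm z < 1 \<Longrightarrow> F z = \<alpha> * z" using S(3) by blast
  \<comment> \<open>At the origin \<open>F z = \<alpha> * z\<close> says nothing about
    \<open>k 0\<close>; uniqueness of the derivative does.\<close>
  have "((\<lambda>z. \<alpha> * z) has_field_derivative k 0) (at 0)"
    using \<open>(F has_field_derivative k 0) (at 0)\<close>
    by (rule has_field_derivative_transform_within_open[where S = "ball 0 1"]) (auto simp: \<alpha>)
  moreover have "((\<lambda>z. \<alpha> * z) has_field_derivative \<alpha>) (at 0)" by (auto intro!: derivative_eq_intros)
  ultimately have k0: "k 0 = \<alpha>" by (rule DERIV_unique)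
  have all: "k w = \<alpha>" if "cmod w < 1" for w
    using \<alpha>[OF that] k0 by (cases "w = 0") (auto simp: F_def)
  show "k z = 1" using all[OF z] all[OF assms(3)] k by simp
qed

lemma norm_hol_disc:
  fixes f :: "complex \<Rightarrow> complex ^ 'n"
  assumes "f \<in> hol_disc (ball 0 1)" "cmod z < 1"
  shows "norm (f z) < 1"
proof -
  have "f ` ball 0 1 \<subseteq> ball 0 1" using assms(1) by (simp add: hol_disc_def)
  moreover have "z \<in> ball 0 1" using assms(2) by simp
  ultimately have "f z \<in> ball 0 1" by blast
  then show ?thesis by simp
qed

text \<open>Pairing the quotient \<open>g\<close> with unit vectors reduces to the scalar lemma. The
  direction of \<open>g z\<close> as test vector bounds its norm by 1; if norm 1 is attained at
  \<xi>, the test vector \<open>g \<xi>\<close> forces \<open>g\<close> to be constant.\<close>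

lemma Schwarz_curve:
  fixes f :: "complex \<Rightarrow> complex ^ 'n"
  assumes "f \<in> hol_disc (ball 0 1)" "f 0 = 0"
  obtains g where "\<And>z. cmod z < 1 \<Longrightarrow> f z = z *s g z" "g \<in> hol_disc (ball 0 1)"
    | v where "norm v = 1" "\<And>z. cmod z < 1 \<Longrightarrow> f z = z *s v"
proof -
  have hol: "(\<lambda>z. f z $ i) holomorphic_on ball 0 1" for i
    using assms(1) by (auto simp: hol_disc_def holomorphic_curve_on_def)
  have fless: "norm (f z) < 1" if "cmod z < 1" for z
    using assms(1) that by (rule norm_hol_disc)
  have "\<exists>h. h holomorphic_on ball 0 1 \<and> (\<forall>z. cmod z < 1 \<longrightarrow> f z $ i = z * h z)" for i
    by (rule Schwarz3[OF hol[of i]]) (use assms(2) in auto)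
  then obtain h where h: "\<And>i. h i holomorphic_on ball 0 1" "\<And>i z. cmod z < 1 \<Longrightarrow> f z $ i = z * h i z"
    by metis
  define g where "g = (\<lambda>z. \<chi> i. h i z)"
  have g: "holomorphic_curve_on g (ball 0 1)" using h(1) by (simp add: holomorphic_curve_on_def g_def)
  have fg: "f z = z *s g z" if "cmod z < 1" for z
    using h(2)[OF that] by (simp add: vec_eq_iff g_def)
  have sc: "(\<lambda>z. cinner (g z) w) holomorphic_on ball 0 1"
    "\<And>z. cmod z < 1 \<Longrightarrow> cmod (z * cinner (g z) w) < 1" if "norm w = 1" for w
    using holomorphic_curve_cinner[OF g] that norm_cinner_less_1[OF fless, of _ w]
    by (auto simp: fg)
  define dir where "dir = (\<lambda>z :: complex ^ 'n. (1 / of_real (norm z)) *s z)"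
  have dir: "norm (dir z) = 1" "cinner z (dir z) = of_real (norm z)" if "z \<noteq> 0" for z :: "complex ^ 'n"
    using that by (simp_all add: dir_def norm_vec_smult norm_divide cinner_self power2_eq_square)
  have le: "norm (g z) \<le> 1" if "cmod z < 1" for z
  proof (cases "g z = 0")
    case False
    have "cmod (cinner (g z) (dir (g z))) \<le> 1"
      by (rule Schwarz_quotient_const(1)[OF sc that]) (use dir(1)[OF False] in auto)
    then show ?thesis unfolding dir(2)[OF False] by simp
  qed simp
  show thesis
  proof (cases "\<exists>z. cmod z < 1 \<and> norm (g z) = 1")
    case False
    then have "norm (g z) < 1" if "cmod z < 1" for z using le[OF that] that by force
    then have "g \<in> hol_disc (ball 0 1)" using g by (auto simp: hol_disc_def)
    with fg show thesis by (rule that(1))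
  next
    case True
    then obtain \<xi> where \<xi>: "cmod \<xi> < 1" "norm (g \<xi>) = 1" by blast
    have "g z = g \<xi>" if "cmod z < 1" for z
    proof -
      have gg: "cinner (g \<xi>) (g \<xi>) = 1" by (simp add: cinner_self \<xi>)
      with Schwarz_quotient_const(2)[OF sc[OF \<xi>(2)] \<xi>(1)] that
      have 1: "cinner (g z) (g \<xi>) = 1" by blast
      then have "cinner (g \<xi>) (g z) = 1" by (metis cnj_cinner complex_cnj_one)
      with 1 gg have "cinner (g z - g \<xi>) (g z - g \<xi>) = cinner (g z) (g z) - 1" by simp
      then have "complex_of_real ((norm (g z - g \<xi>))\<^sup>2) = of_real ((norm (g z))\<^sup>2 - 1)"
        unfolding cinner_self by simp
      then have "(norm (g z - g \<xi>))\<^sup>2 = (norm (g z))\<^sup>2 - 1" by (simp only: of_real_eq_iff)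
      moreover have "(norm (g z))\<^sup>2 \<le> 1" using le[OF that] by (simp add: power_le_one)
      ultimately have "(norm (g z - g \<xi>))\<^sup>2 \<le> 0" by linarith
      then show ?thesis by simp
    qed
    with fg \<xi>(2) show thesis by (intro that(2)) auto
  qed
qed

subsection \<open>The kernel of a composed curve\<close>

lemma one_minus_mult_nz:
  "cmod a < 1 \<Longrightarrow> cmod b \<le> 1 \<Longrightarrow> 1 - a * b \<noteq> 0"
  "cmod a < 1 \<Longrightarrow> cmod b \<le> 1 \<Longrightarrow> 1 - b * a \<noteq> 0"
proof -
  assume "cmod a < 1" "cmod b \<le> 1"
  then have "cmod (a * b) < 1" using mult_left_le[of "cmod b" "cmod a"] by (simp add: norm_mult)
  then show "1 - a * b \<noteq> 0" "1 - b * a \<noteq> 0" by (auto simp: mult.commute)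
qed

text \<open>The one-dimensional counterpart of \<open>ball_aut_kernel\<close>.\<close>

lemma Moebius_kernel:
  assumes "cmod p < 1" "cmod z < 1" "cmod w < 1"
  shows "1 - Moebius_function 0 p z * cnj (Moebius_function 0 p w) =
    (1 - p * cnj p) * (1 - z * cnj w) / ((1 - cnj p * z) * (1 - p * cnj w))"
proof -
  have nz: "1 - cnj p * z \<noteq> 0" "1 - p * cnj w \<noteq> 0"
    using one_minus_mult_nz(1)[of "cnj p" z] one_minus_mult_nz(1)[of p "cnj w"] assms by auto
  have "Moebius_function 0 p z * cnj (Moebius_function 0 p w) =
    ((z - p) * (cnj w - cnj p)) / ((1 - cnj p * z) * (1 - p * cnj w))"
    by (simp add: Moebius_function_simple)
  also have "(z - p) * (cnj w - cnj p) =
     (1 - cnj p * z) * (1 - p * cnj w) - (1 - p * cnj p) * (1 - z * cnj w)"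
    by (simp add: algebra_simps)
  finally show ?thesis using nz by (simp add: diff_divide_distrib)
qed

text \<open>The roots are exchanged by reflection in the unit circle; the strict inequality keeps them
  off the circle.\<close>

lemma self_inversive_quadratic_root:
  fixes h :: complex
  assumes "2 * cmod h < S"
  obtains b where "cmod b < 1" "h * b\<^sup>2 + of_real S * b + cnj h = 0"
proof (cases "h = 0")
  case True
  then show thesis by (intro that[of 0]) auto
next
  case False
  \<comment> \<open>A root is sought on the ray through \<open>- cnj h\<close>: with
    \<open>b = - y * cnj h / cmod h\<close> the equation reduces to \<open>?q y = 0\<close>. This
    real quadratic is positive at 0 and negative at 1.\<close>
  let ?q = "\<lambda>y. cmod h * y\<^sup>2 - S * y + cmod h"
  have "\<exists>y\<ge>0. y \<le> 1 \<and> ?q y = 0"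
    using assms by (intro IVT2) auto
  then obtain y where y: "0 \<le> y" "y \<le> 1" "?q y = 0" by blast
  with assms have "y \<noteq> 1" by auto
  define b where "b = - (of_real (y / cmod h) * cnj h)"
  have "cmod b = y" using False y by (simp add: b_def norm_mult norm_divide)
  then have "cmod b < 1" using y \<open>y \<noteq> 1\<close> by simp
  moreover have "h * b\<^sup>2 = of_real (y\<^sup>2) * cnj h"
  proof -
    have "h * b\<^sup>2 = of_real (y\<^sup>2 / (cmod h)\<^sup>2) * (h * cnj h) * cnj h"
      by (simp add: b_def power2_eq_square)
    then show ?thesis using False by (simp add: complex_norm_square[symmetric] flip: of_real_power)
  qed
  then have "h * b\<^sup>2 + of_real S * b + cnj h = of_real (?q y / cmod h) * cnj h"
    using False by (simp add: b_def field_simps power2_eq_square)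
  then have "h * b\<^sup>2 + of_real S * b + cnj h = 0" using y by simp
  ultimately show thesis by (rule that)
qed

text \<open>The equation says that the Hermitian form \<open>r(z) cnj (r(w)) + C z cnj w\<close>, with
  \<open>r(z) = r0 + r1 z\<close>, has no mixed terms after the change of variable
  \<open>z = (t + b) / (1 + cnj b t)\<close>.\<close>

lemma diagonalising_point:
  fixes r0 r1 :: complex and C :: real
  assumes "C > 0"
  obtains b where "cmod b < 1" "(r0 * cnj b + r1) * cnj (r0 + r1 * b) + of_real C * cnj b = 0"
proof -
  let ?S = "(cmod r0)\<^sup>2 + (cmod r1)\<^sup>2 + C"
  have "0 \<le> (cmod r0 - cmod r1)\<^sup>2" by simp
  then have "2 * cmod (r0 * cnj r1) < ?S"
    using assms by (simp add: norm_mult power2_diff)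
  \<comment> \<open>The point wanted is \<open>cnj c\<close>: in terms of its conjugate, the
    required equation expands to this quadratic.\<close>
  then obtain c where c: "cmod c < 1" "(r0 * cnj r1) * c\<^sup>2 + of_real ?S * c + cnj (r0 * cnj r1) = 0"
    by (rule self_inversive_quadratic_root)
  have "(r0 * c + r1) * cnj (r0 + r1 * cnj c) + of_real C * c
    = (r0 * cnj r1) * c\<^sup>2 + (r0 * cnj r0 + r1 * cnj r1 + of_real C) * c + cnj (r0 * cnj r1)"
    by (simp add: algebra_simps power2_eq_square)
  also have "r0 * cnj r0 + r1 * cnj r1 + of_real C = of_real ?S"
    by (simp only: of_real_add complex_norm_square)
  also note c(2)
  finally show thesis using c(1) by (intro that[of "cnj c"]) auto
qed

text \<open>The kernel identities of the automorphism and the Moebius map multiply, and their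
  denominators combine to the polynomial \<open>r\<close>. The outer factor enters through
  \<open>1 - l * cnj m * G = 1 - l * cnj m + l * cnj m * (1 - G)\<close>, with \<open>G\<close> the
  inner product of the inner curve.\<close>

lemma kernel_of_composition:
  assumes p: "cmod p < 1" and y: "norm y < 1" and v: "norm v = 1"
    and lm: "cmod l < 1" "cmod m < 1"
    and f: "\<And>z. cmod z < 1 \<Longrightarrow> f z = z *s ball_aut y (Moebius_function 0 p z *s v)"
    and r: "\<And>z. r z = (1 + cinner v y * p) - (cnj p + cinner v y) * z"
    and C: "C = (1 - cinner y y) * (1 - p * cnj p)"
  shows "r l \<noteq> 0"
    and "1 - cinner (f l) (f m) =
      (1 - l * cnj m) * (r l * cnj (r m) + C * (l * cnj m)) / (r l * cnj (r m))"
proof -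
  let ?m = "Moebius_function 0 p"
  have m1: "cmod (?m z) < 1" if "cmod z < 1" for z
    using Moebius_function_norm_lt_1[OF p that] .
  have nz: "1 - cnj p * z \<noteq> 0" if "cmod z < 1" for z
    using one_minus_mult_nz(1)[of "cnj p" z] p that by auto
  have b: "cmod (cinner v y) \<le> 1" using norm_cinner_le[of v y] y v by simp
  have r': "r z = (1 - cnj p * z) * (1 - ?m z * cinner v y)" if "cmod z < 1" for z
  proof -
    have "(1 - cnj p * z) * (1 - ?m z * cinner v y) = (1 - cnj p * z) - (z - p) * cinner v y"
      using nz[OF that] by (simp add: right_diff_distrib Moebius_function_simple)
    then show ?thesis unfolding r by (simp add: algebra_simps)
  qed
  have rnz: "r z \<noteq> 0" if "cmod z < 1" for z
    unfolding r'[OF that] using nz[OF that] one_minus_mult_nz(1)[OF m1[OF that] b] by simp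
  from rnz lm show "r l \<noteq> 0" by blast
  have nm: "norm (?m z *s v) < 1" if "cmod z < 1" for z
    using m1[OF that] v by (simp add: norm_vec_smult)
  let ?g = "\<lambda>z. ball_aut y (?m z *s v)"
  have "1 - cinner (?g l) (?g m) = (1 - cinner y y) * (1 - ?m l * cnj (?m m))
     / ((1 - ?m l * cinner v y) * (1 - cnj (?m m) * cinner y v))"
    using ball_aut_kernel[OF y nm[OF lm(1)] nm[OF lm(2)]] v by (simp add: cinner_self)
  also have "\<dots> = C * (1 - l * cnj m) / (r l * cnj (r m))"
    unfolding Moebius_kernel[OF p lm] r'[OF lm(1)] r'[OF lm(2)] C by (simp add: mult_ac)
  finally have g: "1 - cinner (?g l) (?g m) = C * (1 - l * cnj m) / (r l * cnj (r m))" .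
  have "1 - cinner (f l) (f m) = 1 - l * cnj m + l * cnj m * (1 - cinner (?g l) (?g m))"
    using lm by (simp add: f algebra_simps)
  also have "\<dots> = (1 - l * cnj m) * (r l * cnj (r m) + C * (l * cnj m)) / (r l * cnj (r m))"
    unfolding g using rnz[OF lm(1)] rnz[OF lm(2)] by (simp add: field_simps)
  finally show "1 - cinner (f l) (f m) =
      (1 - l * cnj m) * (r l * cnj (r m) + C * (l * cnj m)) / (r l * cnj (r m))" .
qed

text \<open>The diagonalising point \<open>b\<close> turns the second Hermitian factor into
  \<open>h0 + h1 * (t * cnj s)\<close>. Sending \<open>f b\<close> to the origin divides the kernel
  by its values at \<open>(t, 0)\<close> and \<open>(0, s)\<close>, which removes all factors of one
  variable. What remains is \<open>(1 - x) * (1 + k * x)\<close> with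
  \<open>x = t * cnj s\<close>.\<close>

lemma diagonal_kernel:
  assumes p: "cmod p < 1" and y: "norm y < 1" and v: "norm v = 1"
    and f: "\<And>z. cmod z < 1 \<Longrightarrow> f z = z *s ball_aut y (Moebius_function 0 p z *s v)"
    and f1: "\<And>z. cmod z < 1 \<Longrightarrow> norm (f z) < 1"
  obtains b k where "cmod b < 1"
    "\<And>t s. cmod t < 1 \<Longrightarrow> cmod s < 1 \<Longrightarrow>
       cinner (ball_aut (f b) (f (Moebius_function 0 (- b) t))) (ball_aut (f b) (f (Moebius_function 0 (- b) s)))
       = (1 - k) * (t * cnj s) + k * (t * cnj s)\<^sup>2"
proof -
  define C where "C = (1 - (norm y)\<^sup>2) * (1 - (cmod p)\<^sup>2)"
  have "C > 0" unfolding C_def using p y norm_sq_less_1_iff[of y] norm_sq_less_1_iff[of p] by auto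
  have C: "of_real C = (1 - cinner y y) * (1 - p * cnj p)"
    by (simp add: C_def cinner_self complex_norm_square[symmetric] flip: of_real_power)
  define r0 r1 where "r0 = 1 + cinner v y * p" and "r1 = - (cnj p + cinner v y)"
  define r where "r = (\<lambda>z. r0 + r1 * z)"
  have r: "r z = (1 + cinner v y * p) - (cnj p + cinner v y) * z" for z
    by (simp add: r_def r0_def r1_def algebra_simps)
  note K = kernel_of_composition[OF p y v _ _ f r C]
  obtain b where b: "cmod b < 1" "(r0 * cnj b + r1) * cnj (r0 + r1 * b) + of_real C * cnj b = 0"
    by (rule diagonalising_point[OF \<open>C > 0\<close>])
  define d where "d = (\<lambda>t. 1 + cnj b * t)"
  define \<sigma> where "\<sigma> = Moebius_function 0 (- b)"
  define l0 l1 where "l0 = r0 + r1 * b" and "l1 = r0 * cnj b + r1"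
  define l where "l = (\<lambda>t. l0 + l1 * t)"
  define h0 h1 where "h0 = l0 * cnj l0 + of_real C * (b * cnj b)" and "h1 = l1 * cnj l1 + of_real C"
  \<comment> \<open>The mixed coefficients are conjugate to each other: the choice of
    \<open>b\<close> kills that of \<open>t\<close>, hence also that of
    \<open>cnj s\<close>.\<close>
  have cross: "l1 * cnj l0 + of_real C * cnj b = 0"
    using b(2) by (simp add: l0_def l1_def)
  then have "cnj (l1 * cnj l0 + of_real C * cnj b) = 0" by simp
  then have cross': "l0 * cnj l1 + of_real C * b = 0" by (simp add: mult.commute)
  have dnz: "d t \<noteq> 0" if "cmod t < 1" for t
    using one_minus_mult_nz(1)[of "- cnj b" t] b(1) that by (simp add: d_def)
  have \<sigma>: "\<sigma> t = (t + b) / d t" for t by (simp add: \<sigma>_def d_def Moebius_function_simple)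
  have \<sigma>1: "cmod (\<sigma> t) < 1" if "cmod t < 1" for t
    unfolding \<sigma>_def using Moebius_function_norm_lt_1[of "- b" t 0] b(1) that by simp
  have r\<sigma>: "r (\<sigma> t) = l t / d t" if "cmod t < 1" for t
    using dnz[OF that] unfolding \<sigma> r_def
    by (simp add: field_simps) (simp add: l_def d_def l0_def l1_def algebra_simps)
  define c where "c = 1 - b * cnj b"
  have cnz: "c \<noteq> 0" unfolding c_def using one_minus_mult_nz(1)[of b "cnj b"] b(1) by simp
  have lnz: "l t \<noteq> 0" if "cmod t < 1" for t
    using K(1)[OF \<sigma>1[OF that] \<sigma>1[OF that]] r\<sigma>[OF that] by auto
  have ker: "1 - cinner (f (\<sigma> t)) (f (\<sigma> s)) =
      c * (1 - t * cnj s) * (h0 + h1 * (t * cnj s)) / ((d t * l t) * cnj (d s * l s))"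
    if ts: "cmod t < 1" "cmod s < 1" for t s
  proof -
    have k1: "1 - \<sigma> t * cnj (\<sigma> s) = c * (1 - t * cnj s) / (d t * cnj (d s))"
      unfolding \<sigma>_def c_def d_def using Moebius_kernel[of "- b" t s] b(1) ts by simp
    have k2: "r (\<sigma> t) * cnj (r (\<sigma> s)) + of_real C * (\<sigma> t * cnj (\<sigma> s)) =
        (l t * cnj (l s) + of_real C * ((t + b) * (cnj s + cnj b))) / (d t * cnj (d s))"
    proof -
      have "\<sigma> t * cnj (\<sigma> s) = (t + b) * (cnj s + cnj b) / (d t * cnj (d s))" unfolding \<sigma> by simp
      then show ?thesis
        unfolding r\<sigma>[OF ts(1)] r\<sigma>[OF ts(2)]
        by (simp only: add_divide_distrib times_divide_eq_right times_divide_eq_left divide_divide_eq_left complex_cnj_divide)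
    qed
    have k3: "l t * cnj (l s) + of_real C * ((t + b) * (cnj s + cnj b)) = h0 + h1 * (t * cnj s)"
    proof -
      have "l t * cnj (l s) + of_real C * ((t + b) * (cnj s + cnj b)) =
        h0 + h1 * (t * cnj s) + (l1 * cnj l0 + of_real C * cnj b) * t + (l0 * cnj l1 + of_real C * b) * cnj s"
        by (simp add: l_def h0_def h1_def algebra_simps)
      then show ?thesis unfolding cross cross' by simp
    qed
    have "1 - cinner (f (\<sigma> t)) (f (\<sigma> s)) =
        (1 - \<sigma> t * cnj (\<sigma> s)) * (r (\<sigma> t) * cnj (r (\<sigma> s)) + of_real C * (\<sigma> t * cnj (\<sigma> s)))
        / (r (\<sigma> t) * cnj (r (\<sigma> s)))"
      by (rule K(2)[OF \<sigma>1[OF ts(1)] \<sigma>1[OF ts(2)]])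
    also have "\<dots> = (c * (1 - t * cnj s) / (d t * cnj (d s))) * ((h0 + h1 * (t * cnj s)) / (d t * cnj (d s)))
        / ((l t / d t) * cnj (l s / d s))"
      unfolding k1 k2 k3 unfolding r\<sigma>[OF ts(1)] r\<sigma>[OF ts(2)] by (rule refl)
    also have "\<dots> = c * (1 - t * cnj s) * (h0 + h1 * (t * cnj s)) / ((d t * l t) * cnj (d s * l s))"
    proof -
      have *: "X / (p * q) * (Y / (p * q)) / ((u / p) * (w / q)) = X * Y / ((p * u) * (q * w))"
        if "p \<noteq> 0" "q \<noteq> 0" for X Y p q u w :: complex
        using that by (cases "u = 0 \<or> w = 0") (auto simp: field_simps)
      show ?thesis
        unfolding complex_cnj_divide complex_cnj_mult
        by (rule *) (use dnz[OF ts(1)] dnz[OF ts(2)] in simp_all)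
    qed
    finally show ?thesis .
  qed
  have \<sigma>0: "\<sigma> 0 = b" by (simp add: \<sigma> d_def)
  have fb: "norm (f b) < 1" using f1 b(1) by blast
  \<comment> \<open>At \<open>t = s = 0\<close> the kernel is \<open>1 - cinner (f b) (f b)\<close>,
    which is nonzero since \<open>f b\<close> lies in the ball.\<close>
  have h0nz: "h0 \<noteq> 0"
  proof
    assume "h0 = 0"
    then have "1 - cinner (f b) (f b) = 0" using ker[of 0 0] \<sigma>0 by simp
    then show False using one_minus_cinner_nz[OF fb, of "f b"] fb by simp
  qed
  show thesis
  proof (rule that[OF b(1), where k = "h1 / h0"])
    fix t s :: complex assume ts: "cmod t < 1" "cmod s < 1"
    define w where "w = (\<lambda>t. d t * l t)"
    have w: "w t \<noteq> 0" "w s \<noteq> 0" "w 0 \<noteq> 0" 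
      using dnz lnz ts dnz[of 0] lnz[of 0] by (auto simp: w_def)
    have "1 - cinner (ball_aut (f b) (f (\<sigma> t))) (ball_aut (f b) (f (\<sigma> s))) =
      (1 - cinner (f b) (f b)) * (1 - cinner (f (\<sigma> t)) (f (\<sigma> s))) /
        ((1 - cinner (f (\<sigma> t)) (f b)) * (1 - cinner (f b) (f (\<sigma> s))))"
      using f1 \<sigma>1 ts by (intro ball_aut_kernel fb) auto
    also have "\<dots> = (c * h0 / (w 0 * cnj (w 0))) * (c * (1 - t * cnj s) * (h0 + h1 * (t * cnj s)) / (w t * cnj (w s)))
        / ((c * h0 / (w t * cnj (w 0))) * (c * h0 / (w 0 * cnj (w s))))"
      using ker[of 0 0] ker[of t 0] ker[of 0 s] ker[OF ts] ts by (simp add: \<sigma>0 w_def)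
    also have "\<dots> = (1 - t * cnj s) * (h0 + h1 * (t * cnj s)) / h0"
      using w cnz h0nz by (simp add: field_simps)
    finally have "cinner (ball_aut (f b) (f (\<sigma> t))) (ball_aut (f b) (f (\<sigma> s))) =
        1 - (1 - t * cnj s) * (h0 + h1 * (t * cnj s)) / h0"
      by (simp add: algebra_simps)
    also have "\<dots> = (1 - h1 / h0) * (t * cnj s) + h1 / h0 * (t * cnj s)\<^sup>2"
      using h0nz by (simp add: field_simps power2_eq_square)
    finally show "cinner (ball_aut (f b) (f (Moebius_function 0 (- b) t))) (ball_aut (f b) (f (Moebius_function 0 (- b) s)))
       = (1 - h1 / h0) * (t * cnj s) + h1 / h0 * (t * cnj s)\<^sup>2" unfolding \<sigma>_def .
  qed
qed

text \<open>Inner products determine a curve up to a unitary map, and this is the kernel of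
  \<open>t *s A + t\<^sup>2 *s B\<close> for orthogonal \<open>A\<close>, \<open>B\<close> of
  squared norms \<open>1 - k\<close> and \<open>k\<close>.\<close>

lemma curve_from_kernel:
  fixes e :: "complex \<Rightarrow> complex ^ 'n"
  assumes e: "\<And>t s. cmod t < 1 \<Longrightarrow> cmod s < 1 \<Longrightarrow>
      cinner (e t) (e s) = (1 - k) * (t * cnj s) + k * (t * cnj s)\<^sup>2"
  obtains A B where "cinner A B = 0" "cinner A A + cinner B B = 1"
    "\<And>t. cmod t < 1 \<Longrightarrow> e t = t *s A + t\<^sup>2 *s B"
proof -
  \<comment> \<open>On a curve of the expected form these combinations of the values at 1/2 and -1/2
    return exactly \<open>A\<close> and \<open>B\<close>.\<close>
  define A B where "A = e (1/2) - e (-1/2)" and "B = 2 *s (e (1/2) + e (-1/2))"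
  have eA: "cinner (e t) A = (1 - k) * t" and eB: "cinner (e t) B = k * t\<^sup>2" if "cmod t < 1" for t
    using that by (simp_all add: A_def B_def e power2_eq_square field_simps)
  have "cinner A u = cinner (e (1/2)) u - cinner (e (-1/2)) u"
    "cinner B u = 2 * (cinner (e (1/2)) u + cinner (e (-1/2)) u)" for u
    by (simp_all add: A_def B_def)
  then have AA: "cinner A A = 1 - k" and AB: "cinner A B = 0" and BB: "cinner B B = k"
    by (simp_all add: eA eB power2_eq_square)
  have BA: "cinner B A = 0" using AB by (metis cnj_cinner complex_cnj_zero)
  have kr: "cnj k = k" using BB cnj_cinner[of B B] by simp
  show thesis
  proof (rule that)
    show "cinner A B = 0" "cinner A A + cinner B B = 1" using AA AB BB by auto
    fix t :: complex assume t: "cmod t < 1"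
    \<comment> \<open>The remainder is orthogonal to \<open>A\<close>, \<open>B\<close> and
      \<open>e t\<close>, hence to itself.\<close>
    define w where "w = e t - t *s A - t\<^sup>2 *s B"
    have wA: "cinner w A = 0" and wB: "cinner w B = 0"
      by (simp_all add: w_def eA eB t AA AB BA BB)
    have "cinner A (e t) = cnj ((1 - k) * t)" "cinner B (e t) = cnj (k * t\<^sup>2)"
      using eA[OF t] eB[OF t] cnj_cinner by metis+
    then have Ae: "cinner A (e t) = (1 - k) * cnj t" and Be: "cinner B (e t) = k * (cnj t)\<^sup>2"
      by (simp_all add: kr)
    have "cinner w (e t) = cinner (e t) (e t) - t * cinner A (e t) - t\<^sup>2 * cinner B (e t)"
      by (simp add: w_def)
    also have "\<dots> = 0"
      unfolding Ae Be e[OF t t] by (simp add: power2_eq_square algebra_simps)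
    finally have "cinner w (e t) = 0" .
    then have "cinner w w = 0"
      using wA wB by (subst (2) w_def) simp
    then have "w = 0" by simp
    then show "e t = t *s A + t\<^sup>2 *s B" by (simp add: w_def algebra_simps)
  qed
qed

subsection \<open>The left inverse of a curve in normal form\<close>

text \<open>The remainder after projecting onto both vectors has nonnegative squared norm. A zero
  vector contributes 0/0 = 0.\<close>

lemma Bessel_pair:
  assumes "cinner A B = 0"
  shows "(cmod (cinner z A))\<^sup>2 / (norm A)\<^sup>2 + (cmod (cinner z B))\<^sup>2 / (norm B)\<^sup>2 \<le> (norm z)\<^sup>2"
proof -
  define u v where "u = cinner z A / cinner A A" and "v = cinner z B / cinner B B"
  have BA: "cinner B A = 0" using assms by (metis cnj_cinner complex_cnj_zero)
  have uv: "u * cinner A A = cinner z A" "v * cinner B B = cinner z B"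
    by (cases "A = 0"; simp add: u_def) (cases "B = 0"; simp add: v_def)
  define w where "w = z - u *s A - v *s B"
  have "cinner w A = 0" "cinner w B = 0" by (simp_all add: w_def uv assms BA)
  then have "cinner w w = cinner w z" by (subst (2) w_def) simp
  also have "\<dots> = cinner z z - u * cinner A z - v * cinner B z" by (simp add: w_def)
  also have "u * cinner A z = of_real ((cmod (cinner z A))\<^sup>2 / (norm A)\<^sup>2)"
    by (simp add: u_def cinner_self complex_norm_square del: of_real_power)
  also have "v * cinner B z = of_real ((cmod (cinner z B))\<^sup>2 / (norm B)\<^sup>2)"
    by (simp add: v_def cinner_self complex_norm_square del: of_real_power)
  finally have "complex_of_real ((norm w)\<^sup>2) = of_real ((norm z)\<^sup>2
    - (cmod (cinner z A))\<^sup>2 / (norm A)\<^sup>2 - (cmod (cinner z B))\<^sup>2 / (norm B)\<^sup>2)"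
    by (simp only: cinner_self of_real_diff)
  then have "(norm w)\<^sup>2 = (norm z)\<^sup>2 - (cmod (cinner z A))\<^sup>2 / (norm A)\<^sup>2 - (cmod (cinner z B))\<^sup>2 / (norm B)\<^sup>2"
    by (simp only: of_real_eq_iff)
  moreover have "0 \<le> (norm w)\<^sup>2" by simp
  ultimately show ?thesis by linarith
qed

text \<open>For \<open>A = 0\<close> the second summand is \<open>0/0 = 0\<close>, which is the intended value.\<close>

definition left_inverse :: "complex ^ 'n \<Rightarrow> complex ^ 'n \<Rightarrow> complex ^ 'n \<Rightarrow> complex" where
  "left_inverse A B z = (2 * cinner z B + (cinner z A)\<^sup>2 / cinner A A) / (1 + cinner B B)"

lemma one_plus_cinner_self_nz: "1 + cinner B B \<noteq> 0"
proof -
  have "1 + (norm B)\<^sup>2 \<noteq> 0" by (smt (verit) zero_le_power2)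
  moreover have "1 + cinner B B = of_real (1 + (norm B)\<^sup>2)" by (simp add: cinner_self)
  ultimately show ?thesis by (metis of_real_eq_0_iff)
qed

lemma norm_left_inverse:
  assumes "cinner A B = 0" "norm z < 1"
  shows "cmod (left_inverse A B z) < 1"
proof -
  \<comment> \<open>Bessel gives \<open>x\<^sup>2 + y\<^sup>2 < 1\<close> for \<open>y = |cinner z A| / |A|\<close>, so \<open>2|B|x + y\<^sup>2 < 1 + 2|B|x - x\<^sup>2 \<le> 1 + |B|\<^sup>2\<close>.\<close>
  define x where "x = cmod (cinner z B) / norm B"
  have x: "cmod (cinner z B) = norm B * x" by (cases "B = 0") (simp_all add: x_def)
  have "(cmod (cinner z A))\<^sup>2 / (norm A)\<^sup>2 + x\<^sup>2 < 1"
    using Bessel_pair[OF assms(1), of z] assms(2) norm_sq_less_1_iff[of z]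
    by (simp add: x_def power_divide)
  moreover have "0 \<le> (norm B - x)\<^sup>2" by simp
  ultimately have less: "2 * cmod (cinner z B) + (cmod (cinner z A))\<^sup>2 / (norm A)\<^sup>2 < 1 + (norm B)\<^sup>2"
    unfolding x by (simp add: power2_diff)
  have den: "cmod (1 + cinner B B) = 1 + (norm B)\<^sup>2"
  proof -
    have "1 + cinner B B = of_real (1 + (norm B)\<^sup>2)" by (simp add: cinner_self)
    then show ?thesis by (simp only: norm_of_real) simp
  qed
  have "cmod (2 * cinner z B + (cinner z A)\<^sup>2 / cinner A A) \<le> cmod (2 * cinner z B) + cmod ((cinner z A)\<^sup>2 / cinner A A)"
    by (rule norm_triangle_ineq)
  also have "\<dots> = 2 * cmod (cinner z B) + (cmod (cinner z A))\<^sup>2 / (norm A)\<^sup>2"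
    by (simp add: norm_mult norm_divide norm_power cinner_self)
  also note less
  finally show ?thesis
    unfolding left_inverse_def norm_divide den
    by (subst divide_less_eq_1_pos) (auto intro: add_pos_nonneg)
qed

text \<open>The summands of the numerator become \<open>2 * t\<^sup>2 * cinner B B\<close> and
  \<open>t\<^sup>2 * cinner A A\<close>; by the normalisation they add up to
  \<open>t\<^sup>2 * (1 + cinner B B)\<close>.\<close>

lemma left_inverse_eq:
  assumes "cinner A B = 0" "cinner A A + cinner B B = 1"
  shows "left_inverse A B (t *s A + t\<^sup>2 *s B) = t\<^sup>2"
proof -
  have BA: "cinner B A = 0" using assms by (metis cnj_cinner complex_cnj_zero)
  have "(t * cinner A A)\<^sup>2 / cinner A A = t\<^sup>2 * cinner A A"
    by (cases "A = 0") (simp_all add: power2_eq_square)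
  moreover have "cinner A A = 1 - cinner B B" using assms(2) by (simp add: algebra_simps)
  ultimately have "(t * cinner A A)\<^sup>2 / cinner A A = t\<^sup>2 * (1 - cinner B B)" by metis
  then show ?thesis
    unfolding left_inverse_def using one_plus_cinner_self_nz[of B]
    by (simp add: BA assms(1) field_simps)
qed

text \<open>Following both automorphisms by the left inverse of the normal form yields the square of
  a Moebius map, a Blaschke product of degree 2 with double zero \<open>b\<close>.\<close>

lemma geodesic_of_normal_form:
  fixes f :: "complex \<Rightarrow> complex ^ 'n"
  assumes f: "f \<in> hol_disc (ball 0 1)" and b: "cmod b < 1" and xa: "norm x < 1" "norm a < 1"
    and AB: "cinner A B = 0" "cinner A A + cinner B B = 1"
    and e: "\<And>z. cmod z < 1 \<Longrightarrow> ball_aut x (ball_aut a (f z)) =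
      (let t = Moebius_function 0 b z in t *s A + t\<^sup>2 *s B)"
  shows "geodesic 3 (ball 0 1) f"
  unfolding geodesic_def
proof (intro conjI exI)
  let ?G = "\<lambda>z. ball_aut x (ball_aut a z)"
  let ?F = "\<lambda>z. left_inverse A B (?G z)"
  show "f \<in> hol_disc (ball 0 1)" by (rule f)
  have G: "holomorphic_several_on (\<lambda>z. cinner (?G z) v) (ball 0 1)" for v
    by (intro holomorphic_several_ball_aut xa holomorphic_several_cinner norm_ball_aut) auto
  have "?F z = (2 * cinner (?G z) B + (1 / cinner A A) * (cinner (?G z) A * cinner (?G z) A)) / (1 + cinner B B)" for z
    by (simp add: left_inverse_def power2_eq_square)
  then show "holomorphic_several_on ?F (ball 0 1)"
    by (simp only:) (intro holomorphic_several_divide holomorphic_several_add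
        holomorphic_several_mult holomorphic_several_const G one_plus_cinner_self_nz)
  show "?F ` ball 0 1 \<subseteq> unit_disc"
    using norm_left_inverse[OF AB(1) norm_ball_aut[OF xa(1) norm_ball_aut[OF xa(2)]]] by auto
  have F: "(?F \<circ> f) z = (Moebius_function 0 b z)\<^sup>2" if "cmod z < 1" for z
    using left_inverse_eq[OF AB] by (simp add: e[OF that] Let_def)
  show "(2 :: nat) \<le> 3 - 1" by simp
  show "finite_Blaschke 2 (?F \<circ> f)"
    unfolding finite_Blaschke_def
    by (intro exI[of _ 1] exI[of _ "\<lambda>_. b"]) (use b F in \<open>auto simp: power2_eq_square numeral_2_eq_2\<close>)
  show "\<not> (?F \<circ> f) constant_on unit_disc"
  proof
    assume "(?F \<circ> f) constant_on unit_disc"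
    then obtain c where c: "\<And>z. cmod z < 1 \<Longrightarrow> (Moebius_function 0 b z)\<^sup>2 = c"
      using F by (auto simp: constant_on_def)
    have "c = 0" using c[OF b] by (simp add: Moebius_function_eq_zero)
    \<comment> \<open>The Moebius map sends this point to 1/2, so its square takes the value 1/4
      there but 0 at \<open>b\<close>.\<close>
    have M: "cmod (Moebius_function 0 (- b) (1/2)) < 1"
      using Moebius_function_norm_lt_1[of "- b" "1/2" 0] b by simp
    have "Moebius_function 0 b (Moebius_function 0 (- b) (1/2)) = 1/2"
      by (rule Moebius_function_compose) (use b in auto)
    then show False using c[OF M] \<open>c = 0\<close> by simp
  qed
qed

subsection \<open>Extremal curves\<close>

lemma hol_disc_ball_aut:
  assumes "norm a < 1" "f \<in> hol_disc (ball 0 1)"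
  shows "(\<lambda>z. ball_aut a (f z)) \<in> hol_disc (ball 0 1)"
proof -
  have h: "holomorphic_curve_on f (ball 0 1)" using assms(2) by (auto simp: hol_disc_def)
  have 1: "z \<in> ball 0 1 \<Longrightarrow> norm (f z) < 1" for z using norm_hol_disc[OF assms(2)] by simp
  show ?thesis
    using holomorphic_curve_ball_aut[OF assms(1) h 1] norm_ball_aut[OF assms(1) 1]
    by (simp add: hol_disc_def image_subset_iff)
qed

text \<open>The automorphism is an involution preserving the class of competitors, so composing with
  it turns a competitor for the new curve into one for \<open>f\<close>.\<close>

lemma extremal_ball_aut:
  assumes "norm a < 1" "extremal m (ball 0 1) f"
  shows "extremal m (ball 0 1) (\<lambda>z. ball_aut a (f z))"
proof -
  have f: "f \<in> hol_disc (ball 0 1)" using assms(2) by (simp add: extremal_def)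
  have "\<not> (\<exists>h\<in>hol_closed_disc (ball 0 1). \<forall>j\<in>{1..m}. h (l j) = ball_aut a (f (l j)))"
    if l: "distinct_disc_points m l" for l
  proof
    assume "\<exists>h\<in>hol_closed_disc (ball 0 1). \<forall>j\<in>{1..m}. h (l j) = ball_aut a (f (l j))"
    then obtain h where h: "h \<in> hol_closed_disc (ball 0 1)"
      "\<And>j. j \<in> {1..m} \<Longrightarrow> h (l j) = ball_aut a (f (l j))" by blast
    have "ball_aut a (h (l j)) = f (l j)" if "j \<in> {1..m}" for j
    proof -
      have "l j \<in> unit_disc" using l that unfolding distinct_disc_points_def by blast
      then have "norm (f (l j)) < 1" using norm_hol_disc[OF f] by simp
      then show ?thesis using h(2)[OF that] ball_aut_ball_aut[OF assms(1)] by simp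
    qed
    then have "\<exists>h\<in>hol_closed_disc (ball 0 1). \<forall>j\<in>{1..m}. h (l j) = f (l j)"
      by (intro bexI[OF _ hol_closed_disc_ball_aut[OF assms(1) h(1)]]) simp
    moreover have "weak_extremal m (ball 0 1) l f" using assms(2) l by (simp add: extremal_def)
    ultimately show False by (simp add: weak_extremal_def)
  qed
  with hol_disc_ball_aut[OF assms(1) f] show ?thesis
    unfolding extremal_def weak_extremal_def by simp
qed

lemma hol_closed_disc_const: "norm w < 1 \<Longrightarrow> (\<lambda>_. w) \<in> hol_closed_disc (ball 0 1)"
  unfolding hol_closed_disc_def by (intro CollectI exI[of _ UNIV]) (simp add: holomorphic_curve_on_def image_subset_iff)

text \<open>The denominator has no zero on the closed disc, and the bound passes from the open disc
  to the circle by continuity.\<close>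

lemma Moebius_closed_disc:
  assumes "cmod p < 1"
  obtains V where "open V" "cball 0 1 \<subseteq> V" "Moebius_function 0 p holomorphic_on V"
    "\<And>z. z \<in> cball 0 1 \<Longrightarrow> cmod (Moebius_function 0 p z) \<le> 1"
proof
  let ?V = "- {z. 1 - cnj p * z = 0}"
  have "closed {z. 1 - cnj p * z = 0}" by (intro closed_Collect_eq continuous_intros)
  then show "open ?V" by (simp add: open_Compl)
  show V: "cball 0 1 \<subseteq> ?V" using one_minus_mult_nz(1)[of "cnj p"] assms by auto
  show hol: "Moebius_function 0 p holomorphic_on ?V"
    unfolding Moebius_function_simple[abs_def] by (intro holomorphic_intros) auto
  have "continuous_on (cball 0 1) (Moebius_function 0 p)"
    using hol V by (meson holomorphic_on_imp_continuous_on continuous_on_subset)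
  then have cont: "continuous_on (closure (ball 0 1)) (Moebius_function 0 p)" by simp
  show "cmod (Moebius_function 0 p z) \<le> 1" if "z \<in> cball 0 1" for z
    by (rule continuous_on_closure_norm_le[OF cont])
      (use that Moebius_function_norm_lt_1[OF assms] in \<open>auto simp: less_imp_le\<close>)
qed

text \<open>With \<open>g\<close> recentred at \<open>p\<close> in source and target, the Schwarz
  lemma leaves a constant unit vector or a curve \<open>k\<close> in the ball. In the latter case a
  constant value of \<open>k\<close> can replace it, and the new map extends past the circle with
  values in the ball.\<close>

lemma extremal_factor:
  fixes f g :: "complex \<Rightarrow> complex ^ 'n"
  assumes ext: "extremal 3 (ball 0 1) f" and g: "g \<in> hol_disc (ball 0 1)"
    and fg: "\<And>z. cmod z < 1 \<Longrightarrow> f z = z *s g z" and p: "cmod p < 1" "p \<noteq> 0"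
  obtains y v where "norm y < 1" "norm v = 1"
    "\<And>z. cmod z < 1 \<Longrightarrow> g z = ball_aut y (Moebius_function 0 p z *s v)"
proof -
  define y where "y = g p"
  have y: "norm y < 1" unfolding y_def by (rule norm_hol_disc[OF g p(1)])
  let ?m = "Moebius_function 0 p" and ?m' = "Moebius_function 0 (- p)"
  have p': "cmod (- p) < 1" using p by simp
  have m1: "cmod (?m z) < 1" "cmod (?m' z) < 1" if "cmod z < 1" for z
    using Moebius_function_norm_lt_1[OF _ that] p(1) p' by auto
  have inv: "?m' (?m z) = z" if "cmod z < 1" for z
    by (rule Moebius_function_compose) (use p that in auto)
  have gm: "(\<lambda>z. g (?m' z)) \<in> hol_disc (ball 0 1)"
  proof -
    have im: "?m' ` ball 0 1 \<subseteq> ball 0 1" using m1(2) by auto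
    have "holomorphic_curve_on g (ball 0 1)" using g by (simp add: hol_disc_def)
    from holomorphic_curve_compose[OF this Moebius_function_holomorphic[OF p'] im]
    have hol: "holomorphic_curve_on (\<lambda>z. g (?m' z)) (ball 0 1)" .
    have "norm (g (?m' z)) < 1" if "z \<in> ball 0 1" for z
      using norm_hol_disc[OF g m1(2)] that by simp
    then have "(\<lambda>z. g (?m' z)) ` ball 0 1 \<subseteq> ball 0 1" by (simp add: image_subset_iff)
    with hol show ?thesis by (simp add: hol_disc_def)
  qed
  have 0: "ball_aut y (g (?m' 0)) = 0"
    by (simp add: Moebius_function_of_zero ball_aut_self y flip: y_def)
  have gk: "g z = ball_aut y (?m z *s q)"
    if k: "\<And>z. cmod z < 1 \<Longrightarrow> ball_aut y (g (?m' z)) = z *s k z" and z: "cmod z < 1" and q: "k (?m z) = q" for k z q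
  proof -
    have "ball_aut y (g z) = ?m z *s q" using k[OF m1(1)[OF z]] inv[OF z] q by simp
    then show ?thesis using ball_aut_ball_aut[OF y norm_hol_disc[OF g z]] by simp
  qed
  from Schwarz_curve[OF hol_disc_ball_aut[OF y gm] 0] show thesis
  proof cases
    case (2 v)
    have "g z = ball_aut y (?m z *s v)" if "cmod z < 1" for z
      by (rule gk[of "\<lambda>_. v"]) (use 2 that in auto)
    with y 2(1) show thesis by (rule that)
  next
    case (1 k)
    \<comment> \<open>The factor \<open>z\<close> gives agreement at 0 and the zero of
      \<open>?m\<close> gives it at \<open>p\<close>; the free vector \<open>q\<close> is spent on
      agreement at \<open>- p\<close>.\<close>
    define q where "q = k (?m (- p))"
    have q: "norm q < 1" unfolding q_def using norm_hol_disc[OF 1(2) m1(1)] p' by blast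
    obtain V where V: "open V" "cball 0 1 \<subseteq> V" "?m holomorphic_on V"
      "\<And>z. z \<in> cball 0 1 \<Longrightarrow> cmod (?m z) \<le> 1" using Moebius_closed_disc[OF p(1)] by blast
    define h where "h = (\<lambda>z. z *s ball_aut y (?m z *s q))"
    have h: "h \<in> hol_closed_disc (ball 0 1)" unfolding h_def
      by (rule hol_closed_disc_smult[where V = UNIV],
          simp_all, rule hol_closed_disc_ball_aut[OF y], rule hol_closed_disc_smult[OF V(3,1,2,4) hol_closed_disc_const[OF q]])
    \<comment> \<open>\<open>h\<close> contradicts the extremality of \<open>f\<close> at \<open>0, p, -p\<close>.\<close>
    define l where "l = (\<lambda>j :: nat. if j = 1 then 0 else if j = 2 then p else - p)"
    have "{1..3} = {1, 2, 3 :: nat}" by auto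
    moreover have "p \<noteq> - p"
      using p(2) by (metis add_eq_0_iff mult_2 mult_eq_0_iff zero_neq_numeral)
    ultimately have l: "distinct_disc_points 3 l"
      using p by (simp add: distinct_disc_points_def l_def)
    have "h (l j) = f (l j)" for j
    proof -
      have "f 0 = 0" "h 0 = 0" using fg[of 0] by (simp_all add: h_def)
      moreover have "h p = f p" using y fg[OF p(1)] by (simp add: h_def Moebius_function_eq_zero flip: y_def)
      moreover have "h (- p) = f (- p)"
        using fg[OF p'] gk[OF 1(1) p' q_def[symmetric]] by (simp add: h_def)
      ultimately show ?thesis by (simp add: l_def)
    qed
    with h have "\<exists>h\<in>hol_closed_disc (ball 0 1). \<forall>j\<in>{1..3}. h (l j) = f (l j)" by blast
    moreover have "weak_extremal 3 (ball 0 1) l f" using ext l by (simp add: extremal_def)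
    ultimately have False by (simp add: weak_extremal_def)
    then show thesis ..
  qed
qed

theorem theorem5p8:
  fixes f :: "complex \<Rightarrow> complex ^ 'n"
  assumes "extremal 3 unit_ball_C f"
  shows "geodesic 3 unit_ball_C f"
proof -
  note ext = assms[unfolded unit_ball_C_eq]
  have f: "f \<in> hol_disc (ball 0 1)" using ext by (simp add: extremal_def)
  define a where "a = f 0"
  have a: "norm a < 1" unfolding a_def using norm_hol_disc[OF f] by simp
  define f0 where "f0 = (\<lambda>z. ball_aut a (f z))"
  have f0: "f0 \<in> hol_disc (ball 0 1)" "f0 0 = 0" "extremal 3 (ball 0 1) f0"
    using hol_disc_ball_aut[OF a f] extremal_ball_aut[OF a ext] ball_aut_self[OF a]
    by (simp_all add: f0_def a_def)
  from Schwarz_curve[OF f0(1,2)] have "geodesic 3 (ball 0 1) f"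
  proof cases
    case (2 v)
    show ?thesis
    \<comment> \<open>\<open>ball_aut 0\<close> is minus the identity, hence the sign of
      \<open>A\<close>. A straight disc is the case \<open>B = 0\<close> of the normal form.\<close>
    proof (rule geodesic_of_normal_form[OF f, of 0 0 a "- v" 0])
      fix z :: complex assume "cmod z < 1"
      then have "ball_aut a (f z) = z *s v" using 2 by (simp add: f0_def)
      then show "ball_aut 0 (ball_aut a (f z)) = (let t = Moebius_function 0 0 z in t *s (- v) + t\<^sup>2 *s 0)"
        by (simp add: ball_aut_def[of 0] Moebius_function_simple)
    qed (use a 2(1) in \<open>simp_all add: cinner_self\<close>)
  next
    case (1 g)
    \<comment> \<open>Any nonzero point of the disc could take the place of 1/2.\<close>
    obtain y v where yv: "norm y < 1" "norm v = 1"
      "\<And>z. cmod z < 1 \<Longrightarrow> g z = ball_aut y (Moebius_function 0 (1/2) z *s v)"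
      by (rule extremal_factor[OF f0(3) 1(2,1), of "1/2"]) auto
    have f0g: "f0 z = z *s ball_aut y (Moebius_function 0 (1/2) z *s v)" if "cmod z < 1" for z
      using 1(1) yv(3) that by simp
    obtain b k where b: "cmod b < 1" and ker: "\<And>t s. cmod t < 1 \<Longrightarrow> cmod s < 1 \<Longrightarrow>
       cinner (ball_aut (f0 b) (f0 (Moebius_function 0 (- b) t))) (ball_aut (f0 b) (f0 (Moebius_function 0 (- b) s)))
       = (1 - k) * (t * cnj s) + k * (t * cnj s)\<^sup>2"
      by (rule diagonal_kernel[OF _ yv(1,2) f0g norm_hol_disc[OF f0(1)]]) auto
    obtain A B where AB: "cinner A B = 0" "cinner A A + cinner B B = 1"
      and e: "\<And>t. cmod t < 1 \<Longrightarrow> ball_aut (f0 b) (f0 (Moebius_function 0 (- b) t)) = t *s A + t\<^sup>2 *s B"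
      using curve_from_kernel[of "\<lambda>t. ball_aut (f0 b) (f0 (Moebius_function 0 (- b) t))" k] ker by blast
    show ?thesis
    proof (rule geodesic_of_normal_form[OF f b norm_hol_disc[OF f0(1) b] a AB])
      fix z :: complex assume z: "cmod z < 1"
      \<comment> \<open>The normal form \<open>e\<close> is stated in the parameter
        \<open>t\<close>; the point \<open>z\<close> has parameter
        \<open>Moebius_function 0 b z\<close>.\<close>
      have "Moebius_function 0 (- b) (Moebius_function 0 b z) = z"
        by (rule Moebius_function_compose) (use b z in auto)
      with e[OF Moebius_function_norm_lt_1[OF b z, of 0]]
      show "ball_aut (f0 b) (ball_aut a (f z)) = (let t = Moebius_function 0 b z in t *s A + t\<^sup>2 *s B)"
        by (simp add: Let_def f0_def)
    qed
  qed
  then show ?thesis unfolding unit_ball_C_eq .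
qed

end
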